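(* Let $D$ be a set of cardinality $|D|>1$, let $0\notin D$, put $D^{\sim 0}=D\cup\{0\}$, and let $a\in D$ and $c\in D^{\sim 0}$ be different elements. Define binary operations on $D^{\sim 0}$ by $$x\dashv y=\begin{cases}x,&\text{if } y=a,\\ 0,&\text{if } y\in D^{\sim 0}\setminus\{a\},\end{cases}\qquad x\vdash y=\begin{cases}a,&\text{if } x=y=a,\\ c,&\text{if } x\ne a\text{ and }y=a,\\ y,&\text{if } y\in D^{\sim 0}\setminus\{a\}.\end{cases}$$ Then $(D^{\sim 0},\dashv,\vdash)$ is a nonabelian noncommutative dimonoid with $\mathrm{Halo}(D^{\sim 0},\dashv,\vdash)=\{a\}$ and $\mathrm{Aut}(D^{\sim 0},\dashv,\vdash)\cong S_{D^{\sim 0}\setminus\{a,c,0\}}$.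
   Context: A dimonoid is a set $D$ with two associative binary operations $\dashv,\vdash$ satisfying, for all $x,y,z\in D$: $(D_1)$ $(x\dashv y)\dashv z=x\dashv(y\vdash z)$; $(D_2)$ $(x\vdash y)\dashv z=x\vdash(y\dashv z)$; $(D_3)$ $(x\dashv y)\vdash z=x\vdash(y\vdash z)$. A dimonoid is commutative if both $\dashv$ and $\vdash$ are commutative (noncommutative means not commutative). It is abelian if $x\dashv y=y\vdash x$ for all $x,y$ (nonabelian means not abelian). $\mathrm{Halo}(D,\dashv,\vdash)$ is the set of bar-units, i.e. elements $e\in D$ with $e\vdash d=d=d\dashv e$ for all $d\in D$. $\mathrm{Aut}(D,\dashv,\vdash)$ is the group of bijections $D\to D$ preserving both operations. $S_X$ denotes the group of all permutations of the set $X$ (the trivial group if $X=\emptyset$). *)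

theory Defs
  imports "HOL-Algebra.Bij"
begin

record 'a dimonoid = "'a partial_object" +
  lop :: "'a \<Rightarrow> 'a \<Rightarrow> 'a"  (infixl \<open>\<stileturn>\<index>\<close> 70)
  rop :: "'a \<Rightarrow> 'a \<Rightarrow> 'a"  (infixl \<open>\<turnstile>\<index>\<close> 70)

locale dimonoid =
  fixes D (structure)
  assumes lop_closed: "\<lbrakk>x \<in> carrier D; y \<in> carrier D\<rbrakk> \<Longrightarrow> x \<stileturn> y \<in> carrier D"
    and rop_closed: "\<lbrakk>x \<in> carrier D; y \<in> carrier D\<rbrakk> \<Longrightarrow> x \<turnstile> y \<in> carrier D"
    and lop_assoc: "\<lbrakk>x \<in> carrier D; y \<in> carrier D; z \<in> carrier D\<rbrakk>
      \<Longrightarrow> (x \<stileturn> y) \<stileturn> z = x \<stileturn> (y \<stileturn> z)"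
    and rop_assoc: "\<lbrakk>x \<in> carrier D; y \<in> carrier D; z \<in> carrier D\<rbrakk>
      \<Longrightarrow> (x \<turnstile> y) \<turnstile> z = x \<turnstile> (y \<turnstile> z)"
    and D1: "\<lbrakk>x \<in> carrier D; y \<in> carrier D; z \<in> carrier D\<rbrakk>
      \<Longrightarrow> (x \<stileturn> y) \<stileturn> z = x \<stileturn> (y \<turnstile> z)"
    and D2: "\<lbrakk>x \<in> carrier D; y \<in> carrier D; z \<in> carrier D\<rbrakk>
      \<Longrightarrow> (x \<turnstile> y) \<stileturn> z = x \<turnstile> (y \<stileturn> z)"
    and D3: "\<lbrakk>x \<in> carrier D; y \<in> carrier D; z \<in> carrier D\<rbrakk>
      \<Longrightarrow> (x \<stileturn> y) \<turnstile> z = x \<turnstile> (y \<turnstile> z)"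

definition commutative_dimonoid :: "('a, 'm) dimonoid_scheme \<Rightarrow> bool" where
  "commutative_dimonoid D \<longleftrightarrow> dimonoid D \<and>
    (\<forall>x \<in> carrier D. \<forall>y \<in> carrier D. x \<stileturn>\<^bsub>D\<^esub> y = y \<stileturn>\<^bsub>D\<^esub> x) \<and>
    (\<forall>x \<in> carrier D. \<forall>y \<in> carrier D. x \<turnstile>\<^bsub>D\<^esub> y = y \<turnstile>\<^bsub>D\<^esub> x)"

definition abelian_dimonoid :: "('a, 'm) dimonoid_scheme \<Rightarrow> bool" where
  "abelian_dimonoid D \<longleftrightarrow> dimonoid D \<and>
    (\<forall>x \<in> carrier D. \<forall>y \<in> carrier D. x \<stileturn>\<^bsub>D\<^esub> y = y \<turnstile>\<^bsub>D\<^esub> x)"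

definition Halo :: "('a, 'm) dimonoid_scheme \<Rightarrow> 'a set" where
  "Halo D = {e \<in> carrier D. \<forall>d \<in> carrier D. e \<turnstile>\<^bsub>D\<^esub> d = d \<and> d \<stileturn>\<^bsub>D\<^esub> e = d}"

definition dimonoid_auto :: "('a, 'm) dimonoid_scheme \<Rightarrow> ('a \<Rightarrow> 'a) set" where
  "dimonoid_auto D = {h \<in> Bij (carrier D). \<forall>x \<in> carrier D. \<forall>y \<in> carrier D.
    h (x \<stileturn>\<^bsub>D\<^esub> y) = h x \<stileturn>\<^bsub>D\<^esub> h y \<and> h (x \<turnstile>\<^bsub>D\<^esub> y) = h x \<turnstile>\<^bsub>D\<^esub> h y}"

text \<open>As for \<^const>\<open>AutoGroup\<close>, the elements are extensional functions on the carrier,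
  composed by \<^const>\<open>compose\<close>; \<^term>\<open>BijGroup X\<close> is the symmetric group of \<^term>\<open>X\<close>.\<close>

definition Aut :: "('a, 'm) dimonoid_scheme \<Rightarrow> ('a \<Rightarrow> 'a) monoid" where
  "Aut D = BijGroup (carrier D) \<lparr>carrier := dimonoid_auto D\<rparr>"

lemma (in dimonoid) subgroup_dimonoid_auto:
  "subgroup (dimonoid_auto D) (BijGroup (carrier D))"
proof (rule group.subgroupI)
  show "group (BijGroup (carrier D))"
    by (rule group_BijGroup)
  show "dimonoid_auto D \<subseteq> carrier (BijGroup (carrier D))"
    by (auto simp: dimonoid_auto_def BijGroup_def)
  have "(\<lambda>x\<in>carrier D. x) \<in> dimonoid_auto D"
    by (simp add: dimonoid_auto_def id_Bij lop_closed rop_closed)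
  then show "dimonoid_auto D \<noteq> {}" by blast
next
  fix h assume h: "h \<in> dimonoid_auto D"
  then have B: "h \<in> Bij (carrier D)" by (simp add: dimonoid_auto_def)
  then have bij: "bij_betw h (carrier D) (carrier D)" by (simp add: Bij_def)
  let ?g = "inv_into (carrier D) h"
  have g: "?g x \<in> carrier D" "h (?g x) = x" if "x \<in> carrier D" for x
    using bij that by (auto simp: bij_betw_def inv_into_into f_inv_into_f)
  have gh: "?g (h x) = x" if "x \<in> carrier D" for x
    using bij that by (simp add: bij_betw_def inv_into_f_f)
  have "?g (x \<stileturn> y) = ?g x \<stileturn> ?g y \<and> ?g (x \<turnstile> y) = ?g x \<turnstile> ?g y"
    if x: "x \<in> carrier D" and y: "y \<in> carrier D" for x y
  proof -
    have "h (?g x \<stileturn> ?g y) = x \<stileturn> y" "h (?g x \<turnstile> ?g y) = x \<turnstile> y"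
      using h g[OF x] g[OF y] by (simp_all add: dimonoid_auto_def)
    then show ?thesis
      using gh lop_closed rop_closed g[OF x] g[OF y] by metis
  qed
  then show "inv\<^bsub>BijGroup (carrier D)\<^esub> h \<in> dimonoid_auto D"
    using B restrict_inv_into_Bij[OF B]
    by (simp add: inv_BijGroup dimonoid_auto_def lop_closed rop_closed)
next
  fix h k assume "h \<in> dimonoid_auto D" "k \<in> dimonoid_auto D"
  then show "h \<otimes>\<^bsub>BijGroup (carrier D)\<^esub> k \<in> dimonoid_auto D"
    using Bij_imp_funcset[of k "carrier D"]
    by (auto simp: BijGroup_def dimonoid_auto_def compose_Bij compose_eq lop_closed rop_closed
        Pi_iff)
qed

lemma (in dimonoid) group_Aut: "group (Aut D)"
  unfolding Aut_def
  by (rule group.subgroup_imp_group[OF group_BijGroup subgroup_dimonoid_auto])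

definition adjoin_zero :: "'a set \<Rightarrow> 'a \<Rightarrow> 'a \<Rightarrow> 'a \<Rightarrow> 'a dimonoid" where
  "adjoin_zero D z a c =
    \<lparr>carrier = D \<union> {z},
     lop = (\<lambda>x y. if y = a then x else z),
     rop = (\<lambda>x y. if y = a then (if x = a then a else c) else y)\<rparr>"

end

theory Submission
  imports Defs
begin

text \<open>Both operations are built from the test "is this argument \<open>a\<close>?" and the
  constants \<open>a\<close>, \<open>z\<close>, \<open>c\<close> (\<open>z\<close> is the adjoined
  0), so the axioms and the halo come down to case distinctions. An automorphism must fix
  \<open>a\<close>, the only right unit of \<open>\<stileturn>\<close>, hence also
  \<open>z = z \<stileturn> z\<close> and \<open>c = z \<turnstile> a\<close>. Conversely, a
  bijection fixing these three points respects the test and the constants, so it is an automorphism.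
  Thus \<open>Aut\<close> is a pointwise stabilizer, and restriction to the remaining points
  identifies it with their symmetric group.\<close>

lemma pointwise_stabilizer_iso_BijGroup:
  assumes YX: "Y \<subseteq> X"
  shows "BijGroup X \<lparr>carrier := {h \<in> Bij X. \<forall>x \<in> X - Y. h x = x}\<rparr> \<cong> BijGroup Y"
proof -
  let ?S = "{h \<in> Bij X. \<forall>x \<in> X - Y. h x = x}"
  \<comment> \<open>The isomorphism is restriction \<open>?r\<close>; its inverse \<open>?e\<close>
    extends by the identity, cut down to \<open>X\<close> because members of \<open>Bij X\<close>
    are extensional.\<close>
  let ?G = "BijGroup X \<lparr>carrier := ?S\<rparr>"
  let ?r = "\<lambda>h. restrict h Y"
  let ?e = "\<lambda>g. \<lambda>x\<in>X. if x \<in> Y then g x else x"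
  have bij_Y: "bij_betw h Y Y" if h: "h \<in> ?S" for h
  proof -
    have inj: "inj_on h X" and im: "h ` X = X"
      using h by (auto simp: Bij_def bij_betw_def)
    have "h ` (X - Y) = X - Y"
      using h by auto
    \<comment> \<open>An injective map sends the complement of a set to the complement of its
      image.\<close>
    then have "h ` (X - (X - Y)) = X - (X - Y)"
      using inj_on_image_set_diff[OF inj, of X "X - Y"] im by auto
    then have "h ` Y = Y"
      using YX by (simp add: double_diff)
    with inj YX show ?thesis
      by (auto simp: bij_betw_def intro: inj_on_subset)
  qed
  have r: "?r h \<in> Bij Y" if "h \<in> ?S" for h
    using bij_Y[OF that] by (simp add: Bij_def bij_betw_restrict_eq)
  have e: "?e g \<in> ?S" if g: "g \<in> Bij Y" for g
  proof -
    have "bij_betw g Y Y"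
      using g by (simp add: Bij_def)
    then have "bij_betw (\<lambda>x. if x \<in> Y then g x else x) (Y \<union> (X - Y)) (Y \<union> (X - Y))"
      by (intro bij_betw_combine)
         (auto simp: bij_betw_def inj_on_def)
    moreover have "Y \<union> (X - Y) = X" using YX by blast
    ultimately show ?thesis
      by (simp add: Bij_def bij_betw_restrict_eq)
  qed
  have er: "?e (?r h) = h" if "h \<in> ?S" for h
  proof (rule extensionalityI)
    show "?e (?r h) \<in> extensional X" by (rule restrict_extensional)
    show "h \<in> extensional X" using that by (simp add: Bij_def)
    show "?e (?r h) x = h x" if "x \<in> X" for x
      using \<open>h \<in> ?S\<close> that by auto
  qed
  have re: "?r (?e g) = g" if "g \<in> Bij Y" for g
  proof (rule extensionalityI)
    show "?r (?e g) \<in> extensional Y" by (rule restrict_extensional)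
    show "g \<in> extensional Y" using that by (simp add: Bij_def)
    show "?r (?e g) x = g x" if "x \<in> Y" for x
      using that YX by auto
  qed
  have "bij_betw ?r ?S (Bij Y)"
    by (rule bij_betw_byWitness[where f' = ?e]) (use r e er re in blast)+
  moreover have "?r \<in> hom ?G (BijGroup Y)"
  proof (rule homI)
    fix h k assume "h \<in> carrier ?G" "k \<in> carrier ?G"
    then have h: "h \<in> ?S" and k: "k \<in> ?S" by simp_all
    \<comment> \<open>This works because \<open>k\<close> maps \<open>Y\<close> into itself.\<close>
    have "restrict (compose X h k) Y = compose Y (?r h) (?r k)"
      using YX bij_betwE[OF bij_Y[OF k]] by (auto simp: compose_def restrict_def fun_eq_iff)
    then show "?r (h \<otimes>\<^bsub>?G\<^esub> k) = ?r h \<otimes>\<^bsub>BijGroup Y\<^esub> ?r k"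
      using h k r[OF h] r[OF k] by (simp add: BijGroup_def)
  qed (use r in \<open>simp add: BijGroup_def\<close>)
  ultimately show ?thesis
    by (auto simp: is_iso_def iso_def BijGroup_def)
qed

text \<open>Since \<open>z\<close> and \<open>c\<close> differ from \<open>a\<close>, either product
  equals \<open>a\<close> exactly when both factors do, so every test in a triple product is decided
  by the factors alone.\<close>

lemma dimonoid_adjoin_zero:
  assumes "z \<noteq> a" "c \<noteq> a" "c \<in> D \<union> {z}"
  shows "dimonoid (adjoin_zero D z a c)"
  by unfold_locales (use assms in \<open>auto simp: adjoin_zero_def\<close>)

text \<open>If \<open>e \<noteq> a\<close>, then \<open>a \<stileturn> e = z \<noteq> a\<close>, so
  \<open>e\<close> is no bar-unit.\<close>

lemma Halo_adjoin_zero: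
  assumes "z \<noteq> a" "a \<in> D"
  shows "Halo (adjoin_zero D z a c) = {a}"
  using assms by (auto simp: Halo_def adjoin_zero_def)

text \<open>The double complement matches the stabilizer lemma with \<open>Y\<close> the set of
  points other than \<open>a\<close>, \<open>c\<close>, \<open>z\<close>.\<close>

lemma dimonoid_auto_adjoin_zero:
  assumes za: "z \<noteq> a" and ca: "c \<noteq> a" and a: "a \<in> D" and c: "c \<in> D \<union> {z}"
  shows "dimonoid_auto (adjoin_zero D z a c) =
    {h \<in> Bij (D \<union> {z}). \<forall>x \<in> D \<union> {z} - (D \<union> {z} - {a, c, z}). h x = x}"
    (is "?A = ?S")
proof (intro equalityI subsetI)
  let ?X = "D \<union> {z}"
  fix h assume h: "h \<in> ?A"
  have B: "h \<in> Bij ?X"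
    using h by (simp add: dimonoid_auto_def adjoin_zero_def)
  have "\<forall>x\<in>?X. \<forall>y\<in>?X.
      h (if y = a then x else z) = (if h y = a then h x else z) \<and>
      h (if y = a then if x = a then a else c else y) =
        (if h y = a then if h x = a then a else c else h y)"
    using h unfolding dimonoid_auto_def adjoin_zero_def dimonoid.simps partial_object.simps by blast
  then have lop: "h (if y = a then x else z) = (if h y = a then h x else z)"
    and rop: "h (if y = a then if x = a then a else c else y) =
        (if h y = a then if h x = a then a else c else h y)"
    if "x \<in> ?X" "y \<in> ?X" for x y
    using that by blast+
  have inj: "inj_on h ?X"
    using B by (simp add: Bij_def bij_betw_def)
  have ha: "h a = a"
  proof (rule ccontr)
    \<comment> \<open>Applying \<open>h\<close> to \<open>x \<stileturn> a = x\<close> would give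
      \<open>h x = z\<close> for every \<open>x\<close>, in particular for both \<open>a\<close> and
      \<open>z\<close>.\<close>
    assume "h a \<noteq> a"
    then have "h a = z" "h z = z"
      using lop[of a a] lop[of z a] a by auto
    then show False
      using inj za a by (auto dest: inj_onD)
  qed
  have hza: "h z \<noteq> a"
    using inj ha za a by (metis UnCI inj_onD insertI1)
  then have "h z = z"
    using lop[of z z] za by simp
  moreover have "h c = c"
    using rop[of z a] ha hza za a by simp
  ultimately show "h \<in> ?S"
    using B ha by auto
next
  let ?X = "D \<union> {z}"
  fix h assume h: "h \<in> ?S"
  have B: "h \<in> Bij ?X" and fixed: "h a = a" "h z = z" "h c = c"
    using h a c by auto
  \<comment> \<open>By injectivity \<open>h\<close> preserves the test for \<open>a\<close>, on
    which both operations branch.\<close>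
  have "h x = a \<longleftrightarrow> x = a" if "x \<in> ?X" for x
    using B that a fixed(1) by (metis Bij_def IntD2 UnCI bij_betw_def inj_onD mem_Collect_eq)
  then show "h \<in> ?A"
    using B fixed by (simp add: dimonoid_auto_def adjoin_zero_def)
qed

theorem corollary3p3:
  fixes D :: "'a set" and z a c :: 'a
  assumes "infinite D \<or> card D > 1"
    and "z \<notin> D"
    and "a \<in> D"
    and "c \<in> D \<union> {z}"
    and "a \<noteq> c"
  shows "dimonoid (adjoin_zero D z a c) \<and>
    \<not> abelian_dimonoid (adjoin_zero D z a c) \<and>
    \<not> commutative_dimonoid (adjoin_zero D z a c) \<and>
    Halo (adjoin_zero D z a c) = {a} \<and>
    Aut (adjoin_zero D z a c) \<cong> BijGroup ((D \<union> {z}) - {a, c, z})"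
proof -
  have za: "z \<noteq> a" and ca: "c \<noteq> a" using assms by auto
  have "D \<noteq> {a}"
    using assms(1) by auto
  \<comment> \<open>This \<open>b\<close> refutes both laws: \<open>b \<stileturn> b = z\<close> but
    \<open>b \<turnstile> b = b\<close>, and \<open>z \<turnstile> b = b\<close> but
    \<open>b \<turnstile> z = z\<close>.\<close>
  then obtain b where b: "b \<in> D" "b \<noteq> a" "b \<noteq> z"
    using assms(2,3) by blast
  have "\<not> abelian_dimonoid (adjoin_zero D z a c)"
    using b by (auto simp: abelian_dimonoid_def adjoin_zero_def)
  moreover have "\<not> commutative_dimonoid (adjoin_zero D z a c)"
    using b za by (auto simp: commutative_dimonoid_def adjoin_zero_def)
  moreover have "Aut (adjoin_zero D z a c) \<cong> BijGroup ((D \<union> {z}) - {a, c, z})"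
    using pointwise_stabilizer_iso_BijGroup[OF Diff_subset, of "D \<union> {z}" "{a, c, z}"]
    unfolding Aut_def dimonoid_auto_adjoin_zero[OF za ca assms(3,4)]
    by (simp add: adjoin_zero_def)
  ultimately show ?thesis
    using dimonoid_adjoin_zero[OF za ca assms(4)] Halo_adjoin_zero[OF za assms(3)] by blast
qed

end
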